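(* Let $(X,\tau)$ be an extended locally convex space (elcs) with flc topology $\tau_F$. Then the following statements are equivalent: (1) $(X,\tau)$ is semi-reflexive; (2) $(X_{fin}^\rho,\tau|_{X_{fin}^\rho})$ is semi-reflexive for every continuous extended seminorm $\rho$ on $(X,\tau)$; (3) $(X_{fin}^\rho,\tau|_{X_{fin}^\rho})$ is semi-reflexive for some continuous extended seminorm $\rho$ on $(X,\tau)$.
   Context: Vector spaces are over $\mathbb{K}\in\{\mathbb{R},\mathbb{C}\}$. An extended seminorm on a vector space $X$ is a function $\rho:X\to[0,\infty]$ with $\rho(\alpha x)=|\alpha|\rho(x)$ (convention $0\cdot\infty=0$) and $\rho(x+y)\le\rho(x)+\rho(y)$. An extended locally convex space (elcs) is a vector space $X$ with a Hausdorff topology $\tau$ induced by a family $\mathcal{P}$ of extended seminorms, i.e. the translation-invariant topology for which finite intersections of sets $\{x:\rho(x)<r\}$ ($\rho\in\mathcal{P}$, $r>0$) form a neighborhood base at $0$ (scalar multiplication need not be jointly continuous). An extended seminorm $\rho$ is continuous on $(X,\tau)$ iff $\{x:\rho(x)<r\}$ is a $\tau$-neighborhood of $0$ for every $r>0$. Put $X_{fin}^\rho=\{x\in X:\rho(x)<\infty\}$, a subspace of $X$; $\tau|_{X_{fin}^\rho}$ is the subspace topology. The flc topology $\tau_F$ of $(X,\tau)$ is the finest locally convex (vector space) topology on $X$ coarser than $\tau$. $X^*$ denotes the space of $\tau$-continuous linear functionals on $X$. A set $A\subseteq X$ is bounded in an elcs $(X,\tau)$ if for every neighborhood $U$ of $0$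 there are $r>0$ and a finite set $F\subseteq X$ with $A\subseteq F+rU$. $\tau_{ucb}$ is the locally convex topology on $X^*$ induced by the seminorms $\phi\mapsto\sup_{x\in B}|\phi(x)|$, $B$ bounded in $(X,\tau)$. The canonical map is $J:X\to(X^*,\tau_{ucb})^*$, $J(x)=J_x$, $J_x(f)=f(x)$. The elcs $(X,\tau)$ is semi-reflexive if $J$ is surjective. *)

theory Defs
  imports "HOL-Analysis.Analysis" "HOL-Library.Function_Algebras"
begin

text \<open>
  The scalar fields: \<open>\<real>\<close> and \<open>\<complex>\<close>, described up to isometric isomorphism
  so that all notions below are stated once for both.
\<close>

class real_or_complex = real_normed_field +
  assumes ex_embedding_complex:
    "\<exists>h :: 'a \<Rightarrow> complex.
        (\<forall>x y. h (x + y) = h x + h y) \<and>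
        (\<forall>x y. h (x * y) = h x * h y) \<and>
        h 1 = 1 \<and>
        (\<forall>r x. h (r *\<^sub>R x) = r *\<^sub>R h x) \<and>
        (\<forall>x. norm (h x) = norm x) \<and>
        (range h = \<real> \<or> range h = UNIV)"

instance real :: real_or_complex
  by standard (rule exI[of _ complex_of_real],
      auto simp: Reals_def scaleR_conv_of_real)

instance complex :: real_or_complex
  by standard (rule exI[of _ "\<lambda>z. z"], auto)

text \<open>
  A space \<open>(X, \<tau>)\<close> is given by a scalar multiplication on an ambient type and a topology
  \<open>T\<close> with \<open>topspace T = X\<close>, where \<open>X\<close> is a linear subspace of the type. Only the values
  of an extended seminorm on \<open>X\<close> matter. In \<open>ennreal\<close>, \<open>0 * \<infinity> = 0\<close>.
\<close>

definition extended_seminorm ::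
    "('k::real_or_complex \<Rightarrow> 'v::ab_group_add \<Rightarrow> 'v) \<Rightarrow> 'v set \<Rightarrow> ('v \<Rightarrow> ennreal) \<Rightarrow> bool" where
  "extended_seminorm smul X \<rho> \<longleftrightarrow>
     (\<forall>a. \<forall>x\<in>X. \<rho> (smul a x) = ennreal (norm a) * \<rho> x) \<and>
     (\<forall>x\<in>X. \<forall>y\<in>X. \<rho> (x + y) \<le> \<rho> x + \<rho> y)"

definition basic_nbhd :: "'v::ab_group_add set \<Rightarrow> (('v \<Rightarrow> ennreal) \<times> real) set \<Rightarrow> 'v \<Rightarrow> 'v set" where
  "basic_nbhd X F x = {y\<in>X. \<forall>(\<rho>, r)\<in>F. \<rho> (y - x) < ennreal r}"

definition seminorm_topology :: "'v::ab_group_add set \<Rightarrow> ('v \<Rightarrow> ennreal) set \<Rightarrow> 'v topology" where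
  "seminorm_topology X P = topology (\<lambda>U. U \<subseteq> X \<and>
     (\<forall>x\<in>U. \<exists>F. finite F \<and> F \<subseteq> P \<times> {0<..} \<and> basic_nbhd X F x \<subseteq> U))"

lemma openin_seminorm_topology:
  "openin (seminorm_topology X P) U \<longleftrightarrow> U \<subseteq> X \<and>
     (\<forall>x\<in>U. \<exists>F. finite F \<and> F \<subseteq> P \<times> {0<..} \<and> basic_nbhd X F x \<subseteq> U)"
proof -
  let ?N = "\<lambda>x U. \<exists>F. finite F \<and> F \<subseteq> P \<times> {0<..} \<and> basic_nbhd X F x \<subseteq> U"
  let ?O = "\<lambda>U. U \<subseteq> X \<and> (\<forall>x\<in>U. ?N x U)"
  have inter: "?N x (S \<inter> T)" if "?N x S" "?N x T" for x S T
  proof -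
    from that(1) obtain F where F: "finite F" "F \<subseteq> P \<times> {0<..}" "basic_nbhd X F x \<subseteq> S" by blast
    from that(2) obtain G where G: "finite G" "G \<subseteq> P \<times> {0<..}" "basic_nbhd X G x \<subseteq> T" by blast
    have "basic_nbhd X (F \<union> G) x \<subseteq> basic_nbhd X F x \<inter> basic_nbhd X G x"
      unfolding basic_nbhd_def by blast
    then have "basic_nbhd X (F \<union> G) x \<subseteq> S \<inter> T" using F(3) G(3) by blast
    moreover have "finite (F \<union> G)" using F(1) G(1) by simp
    moreover have "F \<union> G \<subseteq> P \<times> {0<..}" using F(2) G(2) by (rule Un_least)
    ultimately show ?thesis by blast
  qed
  have mono: "?N x T" if "?N x S" "S \<subseteq> T" for x S T
    using that by (meson order_trans)
  have "istopology ?O"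
    unfolding istopology_def
  proof (intro conjI allI impI)
    fix S T assume S: "?O S" and T: "?O T"
    show "S \<inter> T \<subseteq> X" using conjunct1[OF S] by (rule le_infI1)
    show "\<forall>x\<in>S \<inter> T. ?N x (S \<inter> T)"
    proof
      fix x assume x: "x \<in> S \<inter> T"
      show "?N x (S \<inter> T)"
        by (rule inter[OF bspec[OF conjunct2[OF S]] bspec[OF conjunct2[OF T]]])
          (use x in simp_all)
    qed
  next
    fix K assume K: "\<forall>S\<in>K. ?O S"
    then show "\<Union>K \<subseteq> X" by blast
    show "\<forall>x\<in>\<Union>K. ?N x (\<Union>K)"
    proof
      fix x assume "x \<in> \<Union>K"
      then obtain S where S: "S \<in> K" "x \<in> S" by blast
      have "?N x S" by (rule bspec[OF conjunct2[OF bspec[OF K S(1)]] S(2)])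
      then show "?N x (\<Union>K)" using Union_upper[OF S(1)] by (rule mono)
    qed
  qed
  then show ?thesis unfolding seminorm_topology_def by (simp only: topology_inverse')
qed

lemma topspace_seminorm_topology [simp]: "topspace (seminorm_topology X P) = X"
proof -
  have "openin (seminorm_topology X P) X"
    unfolding openin_seminorm_topology by (auto simp: basic_nbhd_def intro!: exI[of _ "{}"])
  moreover have "topspace (seminorm_topology X P) \<subseteq> X"
    using openin_topspace[of "seminorm_topology X P"] by (simp only: openin_seminorm_topology)
  ultimately show ?thesis using openin_subset by blast
qed

definition elcs ::
    "('k::real_or_complex \<Rightarrow> 'v::ab_group_add \<Rightarrow> 'v) \<Rightarrow> 'v topology \<Rightarrow> bool" where
  "elcs smul T \<longleftrightarrow>
     vector_space smul \<and> module.subspace smul (topspace T) \<and> Hausdorff_space T \<and>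
     (\<exists>P. (\<forall>\<rho>\<in>P. extended_seminorm smul (topspace T) \<rho>) \<and>
          T = seminorm_topology (topspace T) P)"

definition nbhd_of_zero :: "'v::zero topology \<Rightarrow> 'v set \<Rightarrow> bool" where
  "nbhd_of_zero T U \<longleftrightarrow> U \<subseteq> topspace T \<and> (\<exists>V. openin T V \<and> 0 \<in> V \<and> V \<subseteq> U)"

definition continuous_extended_seminorm ::
    "('k::real_or_complex \<Rightarrow> 'v::ab_group_add \<Rightarrow> 'v) \<Rightarrow> 'v topology \<Rightarrow> ('v \<Rightarrow> ennreal) \<Rightarrow> bool" where
  "continuous_extended_seminorm smul T \<rho> \<longleftrightarrow>
     extended_seminorm smul (topspace T) \<rho> \<and>
     (\<forall>r::real. r > 0 \<longrightarrow> nbhd_of_zero T {x\<in>topspace T. \<rho> x < ennreal r})"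

definition fin_part :: "'v topology \<Rightarrow> ('v \<Rightarrow> ennreal) \<Rightarrow> 'v set" where
  "fin_part T \<rho> = {x\<in>topspace T. \<rho> x < \<infinity>}"

definition locally_convex ::
    "('k::real_or_complex \<Rightarrow> 'v::ab_group_add \<Rightarrow> 'v) \<Rightarrow> 'v topology \<Rightarrow> bool" where
  "locally_convex smul T \<longleftrightarrow>
     (\<exists>P. (\<forall>\<rho>\<in>P. extended_seminorm smul (topspace T) \<rho> \<and> (\<forall>x\<in>topspace T. \<rho> x < \<infinity>)) \<and>
          T = seminorm_topology (topspace T) P)"

definition coarser_topology :: "'v topology \<Rightarrow> 'v topology \<Rightarrow> bool" where
  "coarser_topology S T \<longleftrightarrow> topspace S = topspace T \<and> (\<forall>U. openin S U \<longrightarrow> openin T U)"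

definition flc_topology ::
    "('k::real_or_complex \<Rightarrow> 'v::ab_group_add \<Rightarrow> 'v) \<Rightarrow> 'v topology \<Rightarrow> 'v topology \<Rightarrow> bool" where
  "flc_topology smul T TF \<longleftrightarrow>
     locally_convex smul TF \<and> coarser_topology TF T \<and>
     (\<forall>S. locally_convex smul S \<and> coarser_topology S T \<longrightarrow> coarser_topology S TF)"

text \<open>
  Functionals on \<open>X\<close> are represented by functions that vanish outside \<open>X\<close>, so that the dual
  is a linear subspace of the function type with its pointwise operations and the bidual is
  obtained by applying \<open>dual\<close> again.
\<close>

definition dual ::
    "('k::real_or_complex \<Rightarrow> 'v::ab_group_add \<Rightarrow> 'v) \<Rightarrow> 'v topology \<Rightarrow> ('v \<Rightarrow> 'k) set" where
  "dual smul T = {f.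
     (\<forall>x\<in>topspace T. \<forall>y\<in>topspace T. f (x + y) = f x + f y) \<and>
     (\<forall>a. \<forall>x\<in>topspace T. f (smul a x) = a * f x) \<and>
     (\<forall>x. x \<notin> topspace T \<longrightarrow> f x = 0) \<and>
     continuous_map T euclidean f}"

definition fun_scale :: "'k::real_or_complex \<Rightarrow> ('v \<Rightarrow> 'k) \<Rightarrow> 'v \<Rightarrow> 'k" where
  "fun_scale a f = (\<lambda>x. a * f x)"

definition elcs_bounded ::
    "('k::real_or_complex \<Rightarrow> 'v::ab_group_add \<Rightarrow> 'v) \<Rightarrow> 'v topology \<Rightarrow> 'v set \<Rightarrow> bool" where
  "elcs_bounded smul T A \<longleftrightarrow>
     A \<subseteq> topspace T \<and>
     (\<forall>U. nbhd_of_zero T U \<longrightarrow>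
        (\<exists>r::real. r > 0 \<and> (\<exists>F. finite F \<and> F \<subseteq> topspace T \<and>
           A \<subseteq> {x + smul (of_real r) u | x u. x \<in> F \<and> u \<in> U})))"

definition ucb_topology ::
    "('k::real_or_complex \<Rightarrow> 'v::ab_group_add \<Rightarrow> 'v) \<Rightarrow> 'v topology \<Rightarrow> ('v \<Rightarrow> 'k) topology" where
  "ucb_topology smul T =
     seminorm_topology (dual smul T)
       {(\<lambda>\<phi>. SUP x\<in>B. ennreal (norm (\<phi> x))) | B. elcs_bounded smul T B}"

definition canonical_map ::
    "('k::real_or_complex \<Rightarrow> 'v::ab_group_add \<Rightarrow> 'v) \<Rightarrow> 'v topology \<Rightarrow> 'v \<Rightarrow> ('v \<Rightarrow> 'k) \<Rightarrow> 'k" where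
  "canonical_map smul T x = (\<lambda>f. if f \<in> dual smul T then f x else 0)"

definition semi_reflexive ::
    "('k::real_or_complex \<Rightarrow> 'v::ab_group_add \<Rightarrow> 'v) \<Rightarrow> 'v topology \<Rightarrow> bool" where
  "semi_reflexive smul T \<longleftrightarrow>
     canonical_map smul T ` topspace T = dual fun_scale (ucb_topology smul T)"

text \<open>The flc topology of an elcs always exists.\<close>

lemma flc_topology_exists:
  assumes "elcs smul T"
  shows "\<exists>TF. flc_topology smul T TF"
proof -
  let ?X = "topspace T"
  interpret vector_space smul using assms unfolding elcs_def by blast
  have sub: "subspace ?X" using assms unfolding elcs_def by blast
  obtain P where T: "T = seminorm_topology ?X P" using assms unfolding elcs_def by blast
  have opT: "openin T U = openin (seminorm_topology ?X P) U" for U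
    by (rule arg_cong[OF T, where f = "\<lambda>S. openin S U"])
  define Q where "Q = {\<rho>. continuous_extended_seminorm smul T \<rho> \<and> (\<forall>x\<in>?X. \<rho> x < \<infinity>)}"
  define TF where "TF = seminorm_topology ?X Q"
  have top: "topspace TF = ?X" by (simp add: TF_def)
  have lc: "locally_convex smul TF"
    unfolding locally_convex_def top
    by (rule exI[of _ Q]) (auto simp: TF_def Q_def continuous_extended_seminorm_def)
  have nb: "\<exists>F. finite F \<and> F \<subseteq> P \<times> {0<..} \<and>
      basic_nbhd ?X F 0 \<subseteq> {y\<in>?X. \<sigma> y < ennreal s}"
    if "\<sigma> \<in> Q" "s > 0" for \<sigma> and s :: real
  proof -
    from that have "nbhd_of_zero T {y\<in>?X. \<sigma> y < ennreal s}"
      by (auto simp: Q_def continuous_extended_seminorm_def)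
    then obtain V where V: "openin T V" "0 \<in> V" "V \<subseteq> {y\<in>?X. \<sigma> y < ennreal s}"
      by (auto simp: nbhd_of_zero_def)
    from V(1) have "openin (seminorm_topology ?X P) V" by (rule opT[THEN iffD1])
    then obtain F where "finite F" "F \<subseteq> P \<times> {0<..}"
      "basic_nbhd ?X F 0 \<subseteq> V"
      unfolding openin_seminorm_topology using V(2) by meson
    with V(3) show ?thesis by (meson order_trans)
  qed
  have coarser: "openin T U" if U: "openin TF U" for U
  proof -
    have "openin (seminorm_topology ?X P) U"
      unfolding openin_seminorm_topology
    proof (intro conjI ballI)
      show UX: "U \<subseteq> ?X" using U top openin_subset by blast
      fix x assume x: "x \<in> U"
      obtain F where F: "finite F" "F \<subseteq> Q \<times> {0<..}"
        "basic_nbhd ?X F x \<subseteq> U"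
        using U x unfolding TF_def openin_seminorm_topology by meson
      have "\<forall>p\<in>F. \<exists>G. finite G \<and> G \<subseteq> P \<times> {0<..} \<and>
         basic_nbhd ?X G 0 \<subseteq> {y\<in>?X. fst p y < ennreal (snd p)}"
        using F(2) by (intro ballI nb) auto
      from bchoice[OF this] obtain G where G: "\<forall>p\<in>F. finite (G p) \<and>
         G p \<subseteq> P \<times> {0<..} \<and>
         basic_nbhd ?X (G p) 0 \<subseteq> {y\<in>?X. fst p y < ennreal (snd p)}" ..
      have "basic_nbhd ?X (\<Union>(G ` F)) x \<subseteq> basic_nbhd ?X F x"
      proof
        fix y assume y: "y \<in> basic_nbhd ?X (\<Union>(G ` F)) x"
        then have yX: "y \<in> ?X" by (simp add: basic_nbhd_def)
        then have yx: "y - x \<in> ?X" using subspace_diff[OF sub] x UX by blast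
        have "fst p (y - x) < ennreal (snd p)" if p: "p \<in> F" for p
        proof -
          have "y - x \<in> basic_nbhd ?X (G p) 0"
            using y yx p by (auto simp: basic_nbhd_def)
          then show ?thesis using G p by blast
        qed
        then show "y \<in> basic_nbhd ?X F x" using yX by (auto simp: basic_nbhd_def)
      qed
      then have "basic_nbhd ?X (\<Union>(G ` F)) x \<subseteq> U" using F(3) by (rule order_trans)
      moreover have "finite (\<Union>(G ` F))" using F(1) G by simp
      moreover have "\<Union>(G ` F) \<subseteq> P \<times> {0<..}" using G by (intro UN_least) simp
      ultimately show "\<exists>F. finite F \<and> F \<subseteq> P \<times> {0<..} \<and> basic_nbhd ?X F x \<subseteq> U" by blast
    qed
    then show ?thesis by (rule opT[THEN iffD2])
  qed
  have finest: "openin TF U"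
    if S: "locally_convex smul S" "coarser_topology S T" and U: "openin S U" for S U
  proof -
    have tS: "topspace S = ?X" using S(2) by (simp add: coarser_topology_def)
    obtain R where R: "\<And>\<rho>. \<rho> \<in> R \<Longrightarrow> extended_seminorm smul ?X \<rho>"
      "\<And>\<rho> x. \<rho> \<in> R \<Longrightarrow> x \<in> ?X \<Longrightarrow> \<rho> x < \<infinity>" "S = seminorm_topology ?X R"
      using S(1) unfolding locally_convex_def tS by blast
    have "R \<subseteq> Q"
    proof
      fix \<rho> assume \<rho>: "\<rho> \<in> R"
      have tri: "\<rho> (x + y) \<le> \<rho> x + \<rho> y" if "x \<in> ?X" "y \<in> ?X" for x y
        using R(1)[OF \<rho>] that by (simp add: extended_seminorm_def)
      have "\<rho> (smul 0 0) = ennreal (norm (0::'a)) * \<rho> 0"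
        using R(1)[OF \<rho>] subspace_0[OF sub] unfolding extended_seminorm_def by blast
      then have \<rho>0: "\<rho> 0 = 0" by simp
      have "nbhd_of_zero T {x\<in>?X. \<rho> x < ennreal r}" if r: "r > 0" for r
      proof -
        have "openin S {x\<in>?X. \<rho> x < ennreal r}"
          unfolding R(3) openin_seminorm_topology
        proof (intro conjI ballI)
          fix x assume x: "x \<in> {x\<in>?X. \<rho> x < ennreal r}"
          then obtain t where t: "\<rho> x = ennreal t" "0 \<le> t" 
            by (cases "\<rho> x") auto
          with x r have tr: "t < r" by (simp add: ennreal_less_iff)
          have "\<rho> y < ennreal r" if y: "y \<in> ?X" "\<rho> (y - x) < ennreal (r - t)" for y
          proof -
            have "\<rho> y \<le> \<rho> (y - x) + \<rho> x"
              using tri[of "y - x" x] y(1) x subspace_diff[OF sub] by simp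
            also have "\<dots> < ennreal r"
            proof -
              obtain u where u: "\<rho> (y - x) = ennreal u" "0 \<le> u"
                using y(2) by (cases "\<rho> (y - x)") auto
              then have "u < r - t" using y(2) by (simp add: ennreal_less_iff)
              then show ?thesis
                using u t r by (simp add: ennreal_less_iff flip: ennreal_plus)
            qed
            finally show ?thesis .
          qed
          then show "\<exists>F. finite F \<and> F \<subseteq> R \<times> {0<..} \<and>
             basic_nbhd ?X F x \<subseteq> {x\<in>?X. \<rho> x < ennreal r}"
            using \<rho> tr by (intro exI[of _ "{(\<rho>, r - t)}"]) (auto simp: basic_nbhd_def)
        qed auto
        then have "openin T {x\<in>?X. \<rho> x < ennreal r}"
          using S(2) by (simp add: coarser_topology_def)
        moreover have "0 \<in> {x\<in>?X. \<rho> x < ennreal r}"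
          using \<rho>0 r subspace_0[OF sub] by simp
        ultimately show ?thesis unfolding nbhd_of_zero_def by blast
      qed
      then show "\<rho> \<in> Q"
        using R(1,2)[OF \<rho>] by (simp add: Q_def continuous_extended_seminorm_def)
    qed
    have U': "U \<subseteq> ?X" "\<And>x. x \<in> U \<Longrightarrow> \<exists>F. finite F \<and> F \<subseteq> R \<times> {0<..} \<and>
        basic_nbhd ?X F x \<subseteq> U"
      using U unfolding R(3) openin_seminorm_topology by auto
    have "R \<times> {0::real<..} \<subseteq> Q \<times> {0<..}" using \<open>R \<subseteq> Q\<close> by blast
    show ?thesis
      unfolding TF_def openin_seminorm_topology
    proof (intro conjI ballI)
      show "U \<subseteq> ?X" by (rule U'(1))
      fix x assume "x \<in> U"
      from U'(2)[OF this] obtain F where F: "finite F" "F \<subseteq> R \<times> {0<..}"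
        "basic_nbhd ?X F x \<subseteq> U" by blast
      from F(2) \<open>R \<times> {0::real<..} \<subseteq> Q \<times> {0<..}\<close> have "F \<subseteq> Q \<times> {0<..}" by (rule order_trans)
      with F show "\<exists>F. finite F \<and> F \<subseteq> Q \<times> {0<..} \<and> basic_nbhd ?X F x \<subseteq> U" by blast
    qed
  qed
  have "flc_topology smul T TF"
    unfolding flc_topology_def
  proof (intro conjI allI impI)
    show "locally_convex smul TF" by (rule lc)
    show "coarser_topology TF T"
      unfolding coarser_topology_def using top coarser by simp
    fix S assume S: "locally_convex smul S \<and> coarser_topology S T"
    then have "topspace S = topspace TF" unfolding coarser_topology_def top by blast
    then show "coarser_topology S TF"
      unfolding coarser_topology_def using finest[OF conjunct1[OF S] conjunct2[OF S]] by blast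
  qed
  then show ?thesis by (rule exI)
qed

end

(* Let Y be the open subspace where the continuous extended seminorm is finite, and p a linear
   projection onto Y. Every linear functional that is continuous on Y is continuous, so the dual
   splits as the dual of Y times the full algebraic annihilator of Y. A bounded set meets only
   finitely many cosets of Y, so on the annihilator the ucb topology is the weak-star topology,
   whose dual consists of evaluations; hence only the Y-component matters for
   semi-reflexivity. *)
theory Submission
  imports Defs
begin

text \<open>Translation invariance makes every coset of the open subspace open, so X/Y is discrete
  and X splits topologically as Y times a discrete space, whatever algebraic complement is chosen.
  This is why a projection obtained from a Hamel basis suffices. The obstacle is that scalar
  multiplication on X need not be jointly continuous, so the usual duality of topological vector
  spaces cannot be quoted; continuity on the dual is instead turned into one explicit estimate with
  finitely many bounded sets and a constant, which moves easily along restriction and extension of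
  functionals. Each single \<rho> yields an equivalence with semi-reflexivity of X, so the two
  quantifiers in the statement agree as soon as one continuous \<rho> exists.\<close>

section \<open>Linear functionals vanishing on a finite intersection of kernels\<close>

text \<open>Induction on the number of evaluations: a redundant point \<open>m\<close> is dropped,
  and otherwise a suitable multiple of evaluation at \<open>m\<close> is subtracted from
  \<open>\<Phi>\<close>. Closure of \<open>N\<close> under sums and multiples is all the argument
  asks of it; later \<open>N\<close> is the annihilator of Y in the dual.\<close>

lemma functional_in_span_of_evaluations:
  fixes \<Phi> :: "('v \<Rightarrow> 'k::field) \<Rightarrow> 'k"
  assumes "finite F"
    and add: "\<And>f g. f \<in> N \<Longrightarrow> g \<in> N \<Longrightarrow> (\<lambda>x. f x + g x) \<in> N"
    and scale: "\<And>a f. f \<in> N \<Longrightarrow> (\<lambda>x. a * f x) \<in> N"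
    and "\<And>f g. f \<in> N \<Longrightarrow> g \<in> N \<Longrightarrow> \<Phi> (\<lambda>x. f x + g x) = \<Phi> f + \<Phi> g"
    and "\<And>a f. f \<in> N \<Longrightarrow> \<Phi> (\<lambda>x. a * f x) = a * \<Phi> f"
    and "\<And>f. f \<in> N \<Longrightarrow> (\<And>m. m \<in> F \<Longrightarrow> f m = 0) \<Longrightarrow> \<Phi> f = 0"
  shows "\<exists>c. \<forall>f\<in>N. \<Phi> f = (\<Sum>m\<in>F. c m * f m)"
  using assms(1,4-)
proof (induction F arbitrary: \<Phi> rule: finite_induct)
  case empty
  then show ?case by simp
next
  case (insert m F)
  \<comment> \<open>Since \<open>m\<close> is not in \<open>F\<close>, its coefficient can be set
    without disturbing the others.\<close>
  have ex: "\<exists>c. \<forall>f\<in>N. \<Phi> f = (\<Sum>k\<in>insert m F. c k * f k)"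
    if c: "\<And>f. f \<in> N \<Longrightarrow> \<Phi> f = b * f m + (\<Sum>k\<in>F. c k * f k)" for b c
  proof (intro exI ballI)
    fix f assume "f \<in> N"
    have "(\<Sum>k\<in>F. (c(m := b)) k * f k) = (\<Sum>k\<in>F. c k * f k)"
      using insert.hyps by (intro sum.cong) auto
    then show "\<Phi> f = (\<Sum>k\<in>insert m F. (c(m := b)) k * f k)"
      using c[OF \<open>f \<in> N\<close>] insert.hyps by simp
  qed
  show ?case
  proof (cases "\<forall>f\<in>N. (\<forall>k\<in>F. f k = 0) \<longrightarrow> f m = 0")
    case True
    have "\<exists>c. \<forall>f\<in>N. \<Phi> f = (\<Sum>k\<in>F. c k * f k)"
    proof (rule insert.IH)
      fix f assume f: "f \<in> N" "\<And>k. k \<in> F \<Longrightarrow> f k = 0"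
      then have "f m = 0" using True by blast
      then show "\<Phi> f = 0" using f by (intro insert.prems(3)) auto
    qed (simp_all add: insert.prems)
    then obtain c where "\<forall>f\<in>N. \<Phi> f = (\<Sum>k\<in>F. c k * f k)" ..
    then show ?thesis by (intro ex[of 0 c]) simp
  next
    case False
    then obtain h where h: "h \<in> N" "\<forall>k\<in>F. h k = 0" "h m \<noteq> 0" by blast
    \<comment> \<open>With this value, \<open>\<Phi>\<close> minus \<open>b\<close> times evaluation
      at \<open>m\<close> vanishes at \<open>h\<close>.\<close>
    define b where "b = \<Phi> h / h m"
    have "\<exists>c. \<forall>f\<in>N. \<Phi> f - b * f m = (\<Sum>k\<in>F. c k * f k)"
    proof (rule insert.IH)
      fix f assume f: "f \<in> N" "\<And>k. k \<in> F \<Longrightarrow> f k = 0"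
      \<comment> \<open>Adding this multiple of \<open>h\<close> to \<open>f\<close> kills the value
        at \<open>m\<close> and keeps the zeros on \<open>F\<close>.\<close>
      let ?d = "- (f m / h m)"
      have hN: "(\<lambda>x. ?d * h x) \<in> N" by (rule scale[OF h(1)])
      have "\<Phi> (\<lambda>x. f x + ?d * h x) = 0"
        using f h by (intro insert.prems(3) add hN) auto
      moreover have "\<Phi> (\<lambda>x. f x + ?d * h x) = \<Phi> f + ?d * \<Phi> h"
        by (simp only: insert.prems(1)[OF f(1) hN] insert.prems(2)[OF h(1)])
      ultimately show "\<Phi> f - b * f m = 0" by (simp add: b_def field_simps)
    qed (simp_all add: insert.prems algebra_simps)
    then obtain c where c: "\<forall>f\<in>N. \<Phi> f - b * f m = (\<Sum>k\<in>F. c k * f k)" ..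
    have "\<Phi> f = b * f m + (\<Sum>k\<in>F. c k * f k)" if "f \<in> N" for f
      using c that by (metis add.commute diff_add_cancel)
    then show ?thesis by (rule ex)
  qed
qed

section \<open>The dual and its ucb-continuous functionals\<close>

lemma dual_add: "f \<in> dual smul T \<Longrightarrow> g \<in> dual smul T \<Longrightarrow> f + g \<in> dual smul T"
  unfolding dual_def by (auto simp: algebra_simps plus_fun_def intro!: continuous_map_add)

lemma dual_scale:
  assumes "f \<in> dual smul T"
  shows "fun_scale a f \<in> dual smul T"
proof -
  have "continuous_map T euclidean ((\<lambda>z. a * z) \<circ> f)"
    using assms by (intro continuous_map_compose[of _ euclidean])
      (auto simp: dual_def intro!: continuous_intros)
  then show ?thesis
    using assms by (auto simp: dual_def fun_scale_def algebra_simps o_def)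
qed

lemma dual_diff:
  assumes "f \<in> dual smul T" "g \<in> dual smul T"
  shows "f - g \<in> dual smul T"
proof -
  have "f - g = f + fun_scale (-1) g" by (simp add: fun_eq_iff fun_scale_def)
  then show ?thesis using assms by (metis dual_add dual_scale)
qed

lemma dual_zero: "0 \<in> dual smul T"
  by (simp add: dual_def zero_fun_def)

text \<open>A linear functional is continuous for a family of seminorms exactly when finitely many
  of them dominate it up to a constant. Stating the domination through pointwise bounds by a real
  \<open>t\<close> keeps \<open>ennreal\<close> suprema out of all later arguments.\<close>

lemma dual_ucb_topology_iff:
  fixes smul :: "'k::real_or_complex \<Rightarrow> 'v::ab_group_add \<Rightarrow> 'v"
  shows "\<Phi> \<in> dual fun_scale (ucb_topology smul T) \<longleftrightarrow>
     (\<forall>f\<in>dual smul T. \<forall>g\<in>dual smul T. \<Phi> (f + g) = \<Phi> f + \<Phi> g) \<and>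
     (\<forall>a. \<forall>f\<in>dual smul T. \<Phi> (fun_scale a f) = a * \<Phi> f) \<and>
     (\<forall>f. f \<notin> dual smul T \<longrightarrow> \<Phi> f = 0) \<and>
     (\<exists>\<B> C. finite \<B> \<and> (\<forall>B\<in>\<B>. elcs_bounded smul T B) \<and>
        (\<forall>f\<in>dual smul T. \<forall>t>0. (\<forall>B\<in>\<B>. \<forall>x\<in>B. norm (f x) \<le> t) \<longrightarrow> norm (\<Phi> f) \<le> C * t))"
  (is "_ \<longleftrightarrow> ?add \<and> ?scale \<and> ?zero \<and> ?bound")
proof -
  let ?D = "dual smul T" and ?U = "ucb_topology smul T"
  let ?\<sigma> = "\<lambda>B f. SUP x\<in>B. ennreal (norm (f x))"
  let ?P = "{?\<sigma> B | B. elcs_bounded smul T B}"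
  have top: "topspace ?U = ?D" by (simp add: ucb_topology_def)
  have cont_iff: "continuous_map ?U euclidean \<Phi> \<longleftrightarrow> ?bound" if add: ?add and scale: ?scale
  proof
    assume cont: "continuous_map ?U euclidean \<Phi>"
    have "\<Phi> (fun_scale 0 0) = 0 * \<Phi> 0" using scale dual_zero by blast
    then have \<Phi>0: "\<Phi> 0 = 0" by (simp add: fun_scale_def zero_fun_def)
    \<comment> \<open>Continuity is tested on the unit ball only; homogeneity recovers the size of
      \<open>\<Phi> f\<close>.\<close>
    have "openin ?U {f \<in> ?D. \<Phi> f \<in> ball 0 1}"
      using openin_continuous_map_preimage[OF cont, of "ball 0 1"] top by simp
    moreover have "0 \<in> {f \<in> ?D. \<Phi> f \<in> ball 0 1}" using \<Phi>0 dual_zero by simp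
    ultimately obtain F where F: "finite F" "F \<subseteq> ?P \<times> {0<..}"
      "basic_nbhd ?D F 0 \<subseteq> {f \<in> ?D. \<Phi> f \<in> ball 0 1}"
      unfolding ucb_topology_def openin_seminorm_topology by meson
    have "\<forall>p\<in>F. \<exists>B. elcs_bounded smul T B \<and> fst p = ?\<sigma> B" using F(2) by fastforce
    from bchoice[OF this] obtain b
      where b: "\<forall>p\<in>F. elcs_bounded smul T (b p) \<and> fst p = ?\<sigma> (b p)" ..
    \<comment> \<open>The smallest radius occurring in \<open>F\<close>; the inserted 1 covers an
      empty \<open>F\<close>.\<close>
    define m where "m = Min (insert 1 (snd ` F))"
    have m: "m > 0" using F(1,2) by (auto simp: m_def)
    have mle: "m \<le> snd p" if "p \<in> F" for p using F(1) that by (auto simp: m_def)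
    show ?bound
    proof (intro exI conjI ballI allI impI)
      show "finite (b ` F)" using F(1) by simp
      show "elcs_bounded smul T B" if "B \<in> b ` F" for B using that b by auto
      fix f and t :: real
      assume f: "f \<in> ?D" and t: "t > 0" and le: "\<forall>B\<in>b ` F. \<forall>x\<in>B. norm (f x) \<le> t"
      \<comment> \<open>A bound \<open>t\<close> on \<open>f\<close> becomes \<open>m / 2\<close>
        after scaling. The factor 2 makes the comparison with the radii strict and reappears in the
        constant \<open>2 / m\<close>.\<close>
      define a :: 'k where "a = of_real (m / (2 * t))"
      have na: "norm a = m / (2 * t)" unfolding a_def norm_of_real using m t by simp
      have "(\<rho>, r) \<in> F \<Longrightarrow> \<rho> (fun_scale a f - 0) < ennreal r" for \<rho> r
      proof -
        assume p: "(\<rho>, r) \<in> F"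
        have "\<rho> (fun_scale a f) = ?\<sigma> (b (\<rho>, r)) (fun_scale a f)" using b p by (metis fst_conv)
        also have "\<dots> \<le> ennreal (m / 2)"
        proof (rule SUP_least)
          fix x assume "x \<in> b (\<rho>, r)"
          then have "norm (f x) \<le> t" using le p by blast
          then have "norm a * norm (f x) \<le> (m / (2 * t)) * t"
            unfolding na using m t by (intro mult_left_mono) auto
          then show "ennreal (norm (fun_scale a f x)) \<le> ennreal (m / 2)"
            using t by (auto simp: fun_scale_def norm_mult intro!: ennreal_leI)
        qed
        also have "\<dots> < ennreal r"
          using m mle[OF p] by (simp add: ennreal_less_iff)
        finally show ?thesis by simp
      qed
      then have "fun_scale a f \<in> basic_nbhd ?D F 0"
        using dual_scale[OF f] by (auto simp: basic_nbhd_def)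
      then have "norm (\<Phi> (fun_scale a f)) < 1" using F(3) by auto
      then have "m / (2 * t) * norm (\<Phi> f) < 1" using scale f by (simp add: norm_mult na)
      then show "norm (\<Phi> f) \<le> 2 / m * t" using m t by (simp add: field_simps)
    qed
  next
    assume ?bound
    then obtain \<B> C where \<B>: "finite \<B>" "\<forall>B\<in>\<B>. elcs_bounded smul T B"
      and bd: "\<And>f t. f \<in> ?D \<Longrightarrow> t > 0 \<Longrightarrow> (\<forall>B\<in>\<B>. \<forall>x\<in>B. norm (f x) \<le> t) \<Longrightarrow> norm (\<Phi> f) \<le> C * t"
      by metis
    have "openin ?U {f \<in> ?D. \<Phi> f \<in> W}" if W: "open W" for W
      unfolding ucb_topology_def openin_seminorm_topology
    proof (intro conjI ballI)
      fix f assume "f \<in> {f \<in> ?D. \<Phi> f \<in> W}"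
      then have f: "f \<in> ?D" "\<Phi> f \<in> W" by auto
      from W f(2) obtain e where e: "e > 0" "ball (\<Phi> f) e \<subseteq> W"
        by (meson open_contains_ball)
      \<comment> \<open>The denominator is positive whatever the sign of \<open>C\<close>, and
        \<open>C * t < e\<close> follows.\<close>
      define t where "t = e / (\<bar>C\<bar> + 1)"
      have t: "t > 0" using e by (simp add: t_def)
      have "C * t \<le> \<bar>C\<bar> * t" using t by (intro mult_right_mono) auto
      also have "\<dots> < e" using e by (simp add: t_def field_simps)
      finally have Ct: "C * t < e" .
      let ?F = "(\<lambda>B. (?\<sigma> B, t)) ` \<B>"
      have "g \<in> {f \<in> ?D. \<Phi> f \<in> W}" if "g \<in> basic_nbhd ?D ?F f" for g
      proof -
        from that have g: "g \<in> ?D" "\<And>B. B \<in> \<B> \<Longrightarrow> ?\<sigma> B (g - f) < ennreal t"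
          by (auto simp: basic_nbhd_def)
        have gf: "g - f \<in> ?D" using g(1) f(1) by (rule dual_diff)
        have "norm ((g - f) x) \<le> t" if "B \<in> \<B>" "x \<in> B" for B x
        proof -
          have "ennreal (norm ((g - f) x)) \<le> ?\<sigma> B (g - f)" using that(2) by (rule SUP_upper)
          also have "\<dots> < ennreal t" using that(1) by (rule g(2))
          finally show ?thesis using t by (simp add: ennreal_less_iff)
        qed
        then have "norm (\<Phi> (g - f)) \<le> C * t" using gf t by (intro bd) auto
        moreover have "\<Phi> g = \<Phi> (g - f) + \<Phi> f"
          using add gf f(1) by (metis diff_add_cancel)
        ultimately have "\<Phi> g \<in> ball (\<Phi> f) e" using Ct by (simp add: dist_norm norm_minus_commute)
        then show ?thesis using e(2) g(1) by blast
      qed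
      then show "\<exists>F. finite F \<and> F \<subseteq> ?P \<times> {0<..} \<and> basic_nbhd ?D F f \<subseteq> {f \<in> ?D. \<Phi> f \<in> W}"
        using \<B> t by (intro exI[of _ ?F]) auto
    qed auto
    then show "continuous_map ?U euclidean \<Phi>"
      by (simp add: continuous_map_def top)
  qed
  have "\<Phi> \<in> dual fun_scale ?U \<longleftrightarrow> ?add \<and> ?scale \<and> ?zero \<and> continuous_map ?U euclidean \<Phi>"
    unfolding dual_def[of fun_scale] top by (rule mem_Collect_eq)
  then show ?thesis
    by (rule trans) (intro conj_cong refl cont_iff)
qed

lemma dual_ucb_topologyE:
  assumes "\<Phi> \<in> dual fun_scale (ucb_topology smul T)"
  obtains \<B> C where
    "\<And>f g. f \<in> dual smul T \<Longrightarrow> g \<in> dual smul T \<Longrightarrow> \<Phi> (f + g) = \<Phi> f + \<Phi> g"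
    "\<And>a f. f \<in> dual smul T \<Longrightarrow> \<Phi> (fun_scale a f) = a * \<Phi> f"
    "finite \<B>" "\<And>B. B \<in> \<B> \<Longrightarrow> elcs_bounded smul T B"
    "\<And>f t. f \<in> dual smul T \<Longrightarrow> t > 0 \<Longrightarrow> (\<forall>B\<in>\<B>. \<forall>x\<in>B. norm (f x) \<le> t) \<Longrightarrow>
       norm (\<Phi> f) \<le> C * t"
proof -
  from assms obtain \<B> C where "finite \<B>" "\<forall>B\<in>\<B>. elcs_bounded smul T B"
    "\<forall>f\<in>dual smul T. \<forall>t>0. (\<forall>B\<in>\<B>. \<forall>x\<in>B. norm (f x) \<le> t) \<longrightarrow> norm (\<Phi> f) \<le> C * t"
    unfolding dual_ucb_topology_iff by (elim conjE exE)
  then show thesis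
    using assms by (intro that[of \<B> C]) (simp_all add: dual_ucb_topology_iff)
qed

lemma elcs_bounded_singleton:
  assumes "vector_space smul" and "x \<in> topspace T"
  shows "elcs_bounded smul T {x}"
proof -
  interpret vector_space smul by fact
  show ?thesis
    unfolding elcs_bounded_def
  proof (intro conjI allI impI)
    fix U assume "nbhd_of_zero T U"
    then have "0 \<in> U" by (auto simp: nbhd_of_zero_def)
    then have "x \<in> {y + smul (of_real 1) u | y u. y \<in> {x} \<and> u \<in> U}"
      by (intro CollectI exI[of _ x] exI[of _ 0]) simp
    then show "\<exists>r::real. r > 0 \<and> (\<exists>F. finite F \<and> F \<subseteq> topspace T \<and>
        {x} \<subseteq> {y + smul (of_real r) u | y u. y \<in> F \<and> u \<in> U})"
      using assms(2) by (intro exI[of _ 1] conjI exI[of _ "{x}"]) auto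
  qed (use assms in auto)
qed

text \<open>Evaluation at \<open>x\<close> is dominated, with constant 1, by the seminorm belonging
  to the bounded set \<open>{x}\<close>.\<close>

lemma canonical_map_in_bidual:
  assumes "vector_space smul" and "x \<in> topspace T"
  shows "canonical_map smul T x \<in> dual fun_scale (ucb_topology smul T)"
proof -
  have "\<exists>\<B> C. finite \<B> \<and> (\<forall>B\<in>\<B>. elcs_bounded smul T B) \<and>
        (\<forall>f\<in>dual smul T. \<forall>t>0. (\<forall>B\<in>\<B>. \<forall>x\<in>B. norm (f x) \<le> t) \<longrightarrow>
            norm (canonical_map smul T x f) \<le> C * t)"
    using elcs_bounded_singleton[OF assms]
    by (intro exI[of _ "{{x}}"] exI[of _ 1]) (auto simp: canonical_map_def)
  then show ?thesis
    unfolding dual_ucb_topology_iff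
    by (simp add: canonical_map_def dual_add dual_scale) (simp add: fun_scale_def)
qed

text \<open>One inclusion of the defining equality always holds, so only surjectivity remains.
  Elements of the bidual vanish off the dual, hence they are compared on the dual alone.\<close>

lemma semi_reflexive_iff:
  assumes "vector_space smul"
  shows "semi_reflexive smul T \<longleftrightarrow> (\<forall>\<Phi>\<in>dual fun_scale (ucb_topology smul T).
           \<exists>x\<in>topspace T. \<forall>f\<in>dual smul T. \<Phi> f = f x)"
proof -
  have "\<Phi> = canonical_map smul T x \<longleftrightarrow> (\<forall>f\<in>dual smul T. \<Phi> f = f x)"
    if "\<Phi> \<in> dual fun_scale (ucb_topology smul T)" for \<Phi> x
    using that by (auto simp: canonical_map_def fun_eq_iff dual_ucb_topology_iff)
  then show ?thesis
    unfolding semi_reflexive_def using canonical_map_in_bidual[OF assms]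
    by (auto simp: image_iff set_eq_iff) blast+
qed

section \<open>Translation invariance and the finite part\<close>

text \<open>The interface to the topology for everything below: the generating family of extended
  seminorms is left behind here.\<close>

locale translation_invariant_space = vector_space smul
  for smul :: "'k::real_or_complex \<Rightarrow> 'v::ab_group_add \<Rightarrow> 'v" +
  fixes T :: "'v topology"
  assumes subspace_topspace: "subspace (topspace T)"
    and openin_translation: "openin T U \<Longrightarrow> a \<in> topspace T \<Longrightarrow> openin T ((+) a ` U)"

text \<open>A basic neighborhood depends only on the difference of two points, so the same finite
  family of seminorms and radii serves at the translated point.\<close>

lemma elcs_translation_invariant:
  assumes "elcs smul T"
  shows "translation_invariant_space smul T"
proof -
  let ?X = "topspace T"
  interpret vector_space smul using assms unfolding elcs_def by blast
  have sub: "subspace ?X" using assms unfolding elcs_def by blast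
  obtain P where T: "T = seminorm_topology ?X P" using assms unfolding elcs_def by blast
  show ?thesis
  proof
    fix U a assume U: "openin T U" and a: "a \<in> ?X"
    have UX: "U \<subseteq> ?X" using U by (rule openin_subset)
    have "openin (seminorm_topology ?X P) ((+) a ` U)"
      unfolding openin_seminorm_topology
    proof (intro conjI ballI)
      show "(+) a ` U \<subseteq> ?X" using UX a subspace_add[OF sub] by blast
      fix y assume "y \<in> (+) a ` U"
      then obtain x where x: "x \<in> U" "y = a + x" by blast
      have "openin (seminorm_topology ?X P) U" using U by (subst T[symmetric])
      then obtain F where F: "finite F" "F \<subseteq> P \<times> {0<..}" "basic_nbhd ?X F x \<subseteq> U"
        unfolding openin_seminorm_topology using x(1) by meson
      have "z \<in> (+) a ` U" if "z \<in> basic_nbhd ?X F y" for z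
      proof -
        have "z - a \<in> basic_nbhd ?X F x"
          using that x(2) a subspace_diff[OF sub]
          by (auto simp: basic_nbhd_def algebra_simps)
        then show ?thesis using F(3) by (force intro: image_eqI[of _ _ "z - a"])
      qed
      then show "\<exists>F. finite F \<and> F \<subseteq> P \<times> {0<..} \<and> basic_nbhd ?X F y \<subseteq> (+) a ` U"
        using F by blast
    qed
    then show "openin T ((+) a ` U)" by (subst T)
  qed (rule sub)
qed

lemma (in translation_invariant_space) fin_part_subspace:
  assumes "extended_seminorm smul (topspace T) \<rho>"
  shows "subspace (fin_part T \<rho>)"
proof (rule subspaceI)
  have hom: "\<rho> (smul a x) = ennreal (norm a) * \<rho> x" if "x \<in> topspace T" for a x
    using assms that by (simp add: extended_seminorm_def)
  show "0 \<in> fin_part T \<rho>"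
    using hom[of 0 0] subspace_0[OF subspace_topspace] by (simp add: fin_part_def)
  show "smul c x \<in> fin_part T \<rho>" if "x \<in> fin_part T \<rho>" for c x
    using that hom[of x c] subspace_scale[OF subspace_topspace]
    by (auto simp: fin_part_def ennreal_mult_less_top)
  fix x y assume xy: "x \<in> fin_part T \<rho>" "y \<in> fin_part T \<rho>"
  then have "\<rho> (x + y) \<le> \<rho> x + \<rho> y"
    using assms by (simp add: extended_seminorm_def fin_part_def)
  also have "\<dots> < \<infinity>" using xy by (simp add: fin_part_def)
  finally show "x + y \<in> fin_part T \<rho>"
    using xy subspace_add[OF subspace_topspace] by (simp add: fin_part_def)
qed

text \<open>The finite part contains the unit ball of \<open>\<rho>\<close>, a neighborhood of 0.
  Being a subspace, it contains the translate of that neighborhood to each of its points.\<close>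

lemma (in translation_invariant_space) fin_part_open:
  assumes "continuous_extended_seminorm smul T \<rho>"
  shows "openin T (fin_part T \<rho>)"
proof -
  have sub: "subspace (fin_part T \<rho>)"
    using assms fin_part_subspace by (simp add: continuous_extended_seminorm_def)
  have "nbhd_of_zero T {x\<in>topspace T. \<rho> x < ennreal 1}"
    using assms unfolding continuous_extended_seminorm_def by (metis zero_less_one)
  then obtain V where V: "openin T V" "0 \<in> V" "V \<subseteq> {x\<in>topspace T. \<rho> x < ennreal 1}"
    unfolding nbhd_of_zero_def by blast
  have VY: "V \<subseteq> fin_part T \<rho>"
    using V(3) by (auto simp: fin_part_def intro: less_trans)
  show ?thesis
    unfolding openin_subopen[of T "fin_part T \<rho>"]
  proof
    fix x assume x: "x \<in> fin_part T \<rho>"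
    have "openin T ((+) x ` V)"
      using V(1) x by (intro openin_translation) (auto simp: fin_part_def)
    moreover have "x \<in> (+) x ` V" using V(2) by force
    moreover have "(+) x ` V \<subseteq> fin_part T \<rho>" using VY x subspace_add[OF sub] by blast
    ultimately show "\<exists>S. openin T S \<and> x \<in> S \<and> S \<subseteq> fin_part T \<rho>" by blast
  qed
qed

section \<open>Open subspaces and an algebraic projection\<close>

locale open_subspace = translation_invariant_space smul T
  for smul :: "'k::real_or_complex \<Rightarrow> 'v::ab_group_add \<Rightarrow> 'v" and T :: "'v topology" +
  fixes Y :: "'v set"
  assumes subspace_Y: "subspace Y" and open_Y: "openin T Y"
begin

abbreviation "X \<equiv> topspace T"
abbreviation "TY \<equiv> subtopology T Y"

lemma Y_subset: "Y \<subseteq> X"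
  using open_Y by (rule openin_subset)

lemma topspace_TY [simp]: "topspace TY = Y"
  using Y_subset by auto

declare topspace_subtopology [simp del]

lemma openin_TY: "openin TY U \<longleftrightarrow> openin T U \<and> U \<subseteq> Y"
  by (rule openin_open_subtopology[OF open_Y])

lemma nbhd_of_zero_TY: "nbhd_of_zero TY U \<longleftrightarrow> nbhd_of_zero T U \<and> U \<subseteq> Y"
  using Y_subset unfolding nbhd_of_zero_def openin_TY topspace_TY by (meson subset_trans)

text \<open>By additivity, the behavior of \<open>f\<close> near \<open>x\<close> is a translate of
  its behavior near 0, and a translate of an open subset of \<open>Y\<close> is open in
  \<open>T\<close>.\<close>

lemma continuous_if_continuous_on_Y:
  fixes f :: "'v \<Rightarrow> 'k"
  assumes add: "\<And>x y. x \<in> X \<Longrightarrow> y \<in> X \<Longrightarrow> f (x + y) = f x + f y"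
    and cont: "continuous_map TY euclidean f"
  shows "continuous_map T euclidean f"
proof -
  have "openin T {x \<in> X. f x \<in> W}" if W: "open W" for W
    unfolding openin_subopen[of T "{x \<in> X. f x \<in> W}"]
  proof
    fix x assume "x \<in> {x \<in> X. f x \<in> W}"
    then have x: "x \<in> X" "f x \<in> W" by auto
    have f0: "f 0 = 0"
      using add[of 0 0] subspace_0[OF subspace_topspace] by simp
    have "open ((\<lambda>w. f x + w) -` W)"
      using W by (intro open_vimage continuous_intros)
    then have "openin TY {y \<in> Y. f y \<in> (\<lambda>w. f x + w) -` W}"
      using openin_continuous_map_preimage[OF cont, of "(\<lambda>w. f x + w) -` W"] by simp
    then have "openin T ((+) x ` {y \<in> Y. f x + f y \<in> W})"
      using x by (intro openin_translation) (simp_all add: openin_TY)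
    moreover have "x \<in> (+) x ` {y \<in> Y. f x + f y \<in> W}"
      using f0 x subspace_0[OF subspace_Y] by force
    moreover have "(+) x ` {y \<in> Y. f x + f y \<in> W} \<subseteq> {x \<in> X. f x \<in> W}"
      using add x Y_subset subspace_add[OF subspace_topspace] by (auto simp: subset_iff)
    ultimately show "\<exists>S. openin T S \<and> x \<in> S \<and> S \<subseteq> {x \<in> X. f x \<in> W}" by blast
  qed
  then show ?thesis by (simp add: continuous_map_def)
qed

text \<open>The identity on a Hamel basis of \<open>Y\<close> extends to a linear map of the whole
  ambient type with range \<open>span B = Y\<close>.\<close>

lemma linear_projection_exists:
  "\<exists>p. Vector_Spaces.linear smul smul p \<and> (\<forall>y\<in>Y. p y = y) \<and> range p = Y"
proof -
  interpret vector_space_pair smul smul by unfold_locales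
  obtain B where B: "B \<subseteq> Y" "independent B" "Y \<subseteq> span B"
    by (rule maximal_independent_subset)
  have sB: "span B = Y" using B span_minimal[OF B(1) subspace_Y] by blast
  obtain p where p: "Vector_Spaces.linear smul smul p" "\<forall>x\<in>B. p x = x" "range p = span ((\<lambda>x. x) ` B)"
    using linear_independent_extend_subspace[OF B(2), of "\<lambda>x. x"] by auto
  interpret p: Vector_Spaces.linear smul smul p by (rule p(1))
  have "p y = y" if "y \<in> Y" for y
    using linear_eq_on[OF p(1) linear_id, of y B] that p(2) sB by (simp add: id_def)
  then show ?thesis using p sB by (intro exI[of _ p]) auto
qed

text \<open>One projection is fixed by choice. Since \<open>Y\<close> lies in \<open>X\<close>, the
  complementary part \<open>x - p x\<close> of a point of \<open>X\<close> stays in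
  \<open>X\<close>.\<close>

definition p where
  "p = (SOME p. Vector_Spaces.linear smul smul p \<and> (\<forall>y\<in>Y. p y = y) \<and> range p = Y)"

lemma linear_p: "Vector_Spaces.linear smul smul p"
  and p_id [simp]: "y \<in> Y \<Longrightarrow> p y = y"
  and range_p: "range p = Y"
  using someI_ex[OF linear_projection_exists] unfolding p_def[symmetric] by auto

lemma p_in [simp]: "p x \<in> Y" using range_p by blast

lemma p_add: "p (x + y) = p x + p y" and p_scale: "p (smul a x) = smul a (p x)"
  using linear_p by (simp_all add: Vector_Spaces.linear_iff)

section \<open>Bounded sets under inclusion and projection\<close>

lemma bounded_TY_imp_bounded:
  assumes "elcs_bounded smul TY B"
  shows "elcs_bounded smul T B"
  unfolding elcs_bounded_def
proof (intro conjI allI impI)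
  show "B \<subseteq> X" using assms Y_subset by (auto simp: elcs_bounded_def)
  fix U assume "nbhd_of_zero T U"
  then obtain V where V: "openin T V" "0 \<in> V" "V \<subseteq> U" by (auto simp: nbhd_of_zero_def)
  have "openin TY (V \<inter> Y)"
    unfolding openin_TY using V(1) open_Y by (simp add: openin_Int)
  then have "nbhd_of_zero TY (V \<inter> Y)"
    unfolding nbhd_of_zero_def using V(2) subspace_0[OF subspace_Y] by auto
  then obtain r :: real and F where rF: "r > 0" "finite F" "F \<subseteq> Y"
    "B \<subseteq> {x + smul (of_real r) u | x u. x \<in> F \<and> u \<in> V \<inter> Y}"
    using assms unfolding elcs_bounded_def topspace_TY by blast
  have "B \<subseteq> {x + smul (of_real r) u | x u. x \<in> F \<and> u \<in> U}" using rF(4) V(3) by blast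
  then show "\<exists>r::real. r > 0 \<and> (\<exists>F. finite F \<and> F \<subseteq> X \<and>
      B \<subseteq> {x + smul (of_real r) u | x u. x \<in> F \<and> u \<in> U})"
    using rF(1-3) Y_subset by blast
qed

text \<open>A neighborhood \<open>U\<close> of 0 in \<open>Y\<close> is also one in
  \<open>X\<close>, so it can be used to cover \<open>B\<close>. As \<open>p\<close> fixes the
  multiples of \<open>U\<close>, projecting the cover only moves its centers.\<close>

lemma bounded_imp_projection_bounded:
  assumes "elcs_bounded smul T B"
  shows "elcs_bounded smul TY (p ` B)"
  unfolding elcs_bounded_def topspace_TY
proof (intro conjI allI impI)
  fix U assume "nbhd_of_zero TY U"
  then have U: "nbhd_of_zero T U" "U \<subseteq> Y" by (simp_all add: nbhd_of_zero_TY)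
  then obtain r :: real and F where rF: "r > 0" "finite F"
    "B \<subseteq> {x + smul (of_real r) u | x u. x \<in> F \<and> u \<in> U}"
    using assms unfolding elcs_bounded_def by blast
  have "p ` B \<subseteq> {x + smul (of_real r) u | x u. x \<in> p ` F \<and> u \<in> U}"
  proof
    fix z assume "z \<in> p ` B"
    then obtain x u where xu: "x \<in> F" "u \<in> U" "z = p (x + smul (of_real r) u)"
      using rF(3) by blast
    then have "z = p x + smul (of_real r) u"
      using U(2) subspace_scale[OF subspace_Y] by (auto simp: p_add)
    then show "z \<in> {x + smul (of_real r) u | x u. x \<in> p ` F \<and> u \<in> U}" using xu by blast
  qed
  moreover have "finite (p ` F)" "p ` F \<subseteq> Y" using rF(2) by auto
  ultimately show "\<exists>r::real. r > 0 \<and> (\<exists>F. finite F \<and> F \<subseteq> Y \<and>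
      p ` B \<subseteq> {x + smul (of_real r) u | x u. x \<in> F \<and> u \<in> U})"
    using rF(1) by blast
qed auto

text \<open>Boundedness is tested against the neighborhood \<open>Y\<close> itself: scaling keeps
  \<open>Y\<close> inside itself, so \<open>B\<close> lies in \<open>F + Y\<close>, and
  \<open>x - p x\<close> depends only on the coset of \<open>x\<close>.\<close>

lemma bounded_imp_finite_cosets:
  assumes "elcs_bounded smul T B"
  shows "finite ((\<lambda>x. x - p x) ` B)"
proof -
  have "nbhd_of_zero T Y"
    using open_Y Y_subset subspace_0[OF subspace_Y] unfolding nbhd_of_zero_def by blast
  then obtain r :: real and F where rF: "finite F"
    "B \<subseteq> {x + smul (of_real r) u | x u. x \<in> F \<and> u \<in> Y}"
    using assms unfolding elcs_bounded_def by blast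
  have "(\<lambda>x. x - p x) ` B \<subseteq> (\<lambda>x. x - p x) ` F"
  proof
    fix z assume "z \<in> (\<lambda>x. x - p x) ` B"
    then obtain x u where xu: "x \<in> F" "u \<in> Y"
      "z = x + smul (of_real r) u - p (x + smul (of_real r) u)"
      using rF(2) by blast
    then have "z = x - p x" using subspace_scale[OF subspace_Y] by (simp add: p_add)
    then show "z \<in> (\<lambda>x. x - p x) ` F" using xu by blast
  qed
  then show ?thesis using rF(1) by (meson finite_imageI finite_subset)
qed

section \<open>Extension and restriction of functionals\<close>

text \<open>Pullback along \<open>p\<close>: it embeds the dual of \<open>Y\<close> in the dual of
  \<open>X\<close> as a complement of the annihilator of \<open>Y\<close>.\<close>

definition extend :: "('v \<Rightarrow> 'k) \<Rightarrow> 'v \<Rightarrow> 'k" where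
  "extend g x = (if x \<in> X then g (p x) else 0)"

definition restr :: "('v \<Rightarrow> 'k) \<Rightarrow> 'v \<Rightarrow> 'k" where
  "restr f x = (if x \<in> Y then f x else 0)"

lemma dual_TY_D:
  assumes "g \<in> dual smul TY"
  shows "x \<in> Y \<Longrightarrow> y \<in> Y \<Longrightarrow> g (x + y) = g x + g y"
    and "x \<in> Y \<Longrightarrow> g (smul a x) = a * g x"
    and "x \<notin> Y \<Longrightarrow> g x = 0"
    and "continuous_map TY euclidean g"
  using assms by (auto simp: dual_def)

lemma dual_T_I:
  assumes "\<And>x y. x \<in> X \<Longrightarrow> y \<in> X \<Longrightarrow> f (x + y) = f x + f y"
    and "\<And>a x. x \<in> X \<Longrightarrow> f (smul a x) = a * f x"
    and "\<And>x. x \<notin> X \<Longrightarrow> f x = 0"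
    and "continuous_map TY euclidean f"
  shows "f \<in> dual smul T"
  using assms continuous_if_continuous_on_Y[of f] by (auto simp: dual_def)

text \<open>On \<open>Y\<close> the extension agrees with \<open>g\<close>, and continuity there is
  enough.\<close>

lemma extend_dual:
  assumes "g \<in> dual smul TY"
  shows "extend g \<in> dual smul T"
proof (rule dual_T_I)
  show "continuous_map TY euclidean (extend g)"
    using dual_TY_D(4)[OF assms]
    by (rule continuous_map_eq) (use Y_subset in \<open>auto simp: extend_def\<close>)
qed (auto simp: extend_def p_add p_scale dual_TY_D[OF assms]
      subspace_add[OF subspace_topspace] subspace_scale[OF subspace_topspace])

lemma restr_dual:
  assumes "f \<in> dual smul T"
  shows "restr f \<in> dual smul TY"
proof -
  have "continuous_map TY euclidean f"
    using assms by (auto simp: dual_def intro: continuous_map_from_subtopology)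
  then have "continuous_map TY euclidean (restr f)"
    by (rule continuous_map_eq) (simp add: restr_def)
  then show ?thesis
    using assms Y_subset subspace_add[OF subspace_Y] subspace_scale[OF subspace_Y]
    unfolding dual_def topspace_TY by (auto simp: restr_def subset_iff)
qed

lemma restr_extend:
  assumes "g \<in> dual smul TY"
  shows "restr (extend g) = g"
  using dual_TY_D(3)[OF assms] Y_subset by (auto simp: fun_eq_iff restr_def extend_def)

text \<open>Any algebraic functional composed with \<open>x - p x\<close> vanishes on
  \<open>Y\<close>, hence is continuous; it only has to be nonzero at the component of
  \<open>x\<close> outside \<open>Y\<close>.\<close>

lemma dual_separates_from_Y:
  assumes "x \<in> X" "x \<notin> Y"
  shows "\<exists>f\<in>dual smul T. restr f = 0 \<and> f x \<noteq> 0"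
proof -
  interpret vp: vector_space_pair smul "(*) :: 'k \<Rightarrow> 'k \<Rightarrow> 'k"
    by unfold_locales (auto simp: algebra_simps)
  define v where "v = x - p x"
  have "v \<noteq> 0" unfolding v_def using assms(2) p_in by (metis eq_iff_diff_eq_0)
  then have "independent {v}" by simp
  from vp.linear_independent_extend[OF this, of "\<lambda>_. 1"]
  obtain h where h: "Vector_Spaces.linear smul (*) h" "h v = 1" by auto
  have hadd: "h (a + b) = h a + h b" and hscale: "h (smul c a) = c * h a" for a b c
    using h(1) by (simp_all add: Vector_Spaces.linear_iff)
  have h0: "h 0 = 0" using hadd[of 0 0] by simp
  define f where "f z = (if z \<in> X then h (z - p z) else 0)" for z
  have fY: "f y = 0" if "y \<in> Y" for y using that h0 by (simp add: f_def)
  have "f \<in> dual smul T"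
  proof (rule dual_T_I)
    have "continuous_map TY euclidean (\<lambda>_. 0::'k)" by simp
    then show "continuous_map TY euclidean f"
      by (rule continuous_map_eq) (simp add: fY)
    show "f (y + z) = f y + f z" if "y \<in> X" "z \<in> X" for y z
      using that subspace_add[OF subspace_topspace] hadd[of "y - p y" "z - p z"]
      by (simp add: f_def p_add algebra_simps)
    show "f (smul a z) = a * f z" if "z \<in> X" for a z
      using that subspace_scale[OF subspace_topspace] hscale[of a "z - p z"]
      by (simp add: f_def p_scale scale_right_diff_distrib)
  qed (simp add: f_def)
  moreover have "restr f = 0" using fY by (auto simp: fun_eq_iff restr_def)
  moreover have "f x \<noteq> 0" using h(2) assms by (simp add: f_def v_def)
  ultimately show ?thesis by blast
qed

section \<open>Transfer of semi-reflexivity between X and Y\<close>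

lemma semi_reflexive_subspace:
  assumes "semi_reflexive smul T"
  shows "semi_reflexive smul TY"
  unfolding semi_reflexive_iff[OF vector_space_axioms] topspace_TY
proof
  fix \<Psi> assume "\<Psi> \<in> dual fun_scale (ucb_topology smul TY)"
  then obtain \<B> C where \<Psi>:
    "\<And>f g. f \<in> dual smul TY \<Longrightarrow> g \<in> dual smul TY \<Longrightarrow> \<Psi> (f + g) = \<Psi> f + \<Psi> g"
    "\<And>a f. f \<in> dual smul TY \<Longrightarrow> \<Psi> (fun_scale a f) = a * \<Psi> f"
    and \<B>: "finite \<B>" "\<And>B. B \<in> \<B> \<Longrightarrow> elcs_bounded smul TY B"
    and bd: "\<And>f t. f \<in> dual smul TY \<Longrightarrow> t > 0 \<Longrightarrow> (\<forall>B\<in>\<B>. \<forall>x\<in>B. norm (f x) \<le> t) \<Longrightarrow>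
       norm (\<Psi> f) \<le> C * t"
    by (rule dual_ucb_topologyE) (rule that; assumption)
  have \<Psi>0: "\<Psi> 0 = 0" using \<Psi>(1)[OF dual_zero dual_zero] by simp
  \<comment> \<open>Composition with restriction satisfies the same estimate, with the same bounded
    sets and constant.\<close>
  define \<Phi> where "\<Phi> f = (if f \<in> dual smul T then \<Psi> (restr f) else 0)" for f
  have "\<Phi> \<in> dual fun_scale (ucb_topology smul T)"
    unfolding dual_ucb_topology_iff
  proof (intro conjI ballI allI impI exI)
    fix f g assume fg: "f \<in> dual smul T" "g \<in> dual smul T"
    have "restr (f + g) = restr f + restr g" by (auto simp: fun_eq_iff restr_def)
    then show "\<Phi> (f + g) = \<Phi> f + \<Phi> g"
      using fg by (simp add: \<Phi>_def dual_add \<Psi>(1) restr_dual)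
  next
    fix a f assume f: "f \<in> dual smul T"
    have "restr (fun_scale a f) = fun_scale a (restr f)"
      by (auto simp: fun_eq_iff restr_def fun_scale_def)
    then show "\<Phi> (fun_scale a f) = a * \<Phi> f"
      using f by (simp add: \<Phi>_def dual_scale \<Psi>(2) restr_dual)
  next
    show "elcs_bounded smul T B" if "B \<in> \<B>" for B
      using that by (intro bounded_TY_imp_bounded \<B>(2))
    fix f and t :: real
    assume "f \<in> dual smul T" "t > 0" "\<forall>B\<in>\<B>. \<forall>x\<in>B. norm (f x) \<le> t"
    then show "norm (\<Phi> f) \<le> C * t"
      using bd[OF restr_dual, of f t] by (auto simp: \<Phi>_def restr_def)
  qed (use \<B>(1) in \<open>auto simp: \<Phi>_def\<close>)
  then obtain x where x: "x \<in> X" "\<And>f. f \<in> dual smul T \<Longrightarrow> \<Phi> f = f x"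
    using assms unfolding semi_reflexive_iff[OF vector_space_axioms] by blast
  \<comment> \<open>The lifted functional kills every \<open>f\<close> that vanishes on
    \<open>Y\<close>, so a representing point outside \<open>Y\<close> would contradict
    separation.\<close>
  have xY: "x \<in> Y"
  proof (rule ccontr)
    assume "x \<notin> Y"
    then obtain f where f: "f \<in> dual smul T" "restr f = 0" "f x \<noteq> 0"
      using dual_separates_from_Y x(1) by blast
    then have "\<Phi> f = 0" using \<Psi>0 by (simp add: \<Phi>_def)
    then show False using x(2) f by simp
  qed
  have "\<Psi> g = g x" if "g \<in> dual smul TY" for g
    using x(2)[OF extend_dual[OF that]] extend_dual[OF that] restr_extend[OF that] x(1) xY
    by (simp add: \<Phi>_def extend_def)
  then show "\<exists>x\<in>Y. \<forall>g\<in>dual smul TY. \<Psi> g = g x" using xY by blast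
qed

text \<open>The representing point is \<open>y + z\<close>: \<open>y\<close> in \<open>Y\<close>
  comes from semi-reflexivity of \<open>Y\<close>, and \<open>z\<close> represents
  \<open>\<Phi>\<close> on the annihilator of \<open>Y\<close>.\<close>

lemma semi_reflexive_ambient:
  assumes "semi_reflexive smul TY"
  shows "semi_reflexive smul T"
  unfolding semi_reflexive_iff[OF vector_space_axioms]
proof
  fix \<Phi> assume "\<Phi> \<in> dual fun_scale (ucb_topology smul T)"
  then obtain \<B> C where \<Phi>:
    "\<And>f g. f \<in> dual smul T \<Longrightarrow> g \<in> dual smul T \<Longrightarrow> \<Phi> (f + g) = \<Phi> f + \<Phi> g"
    "\<And>a f. f \<in> dual smul T \<Longrightarrow> \<Phi> (fun_scale a f) = a * \<Phi> f"
    and \<B>: "finite \<B>" "\<And>B. B \<in> \<B> \<Longrightarrow> elcs_bounded smul T B"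
    and bd: "\<And>f t. f \<in> dual smul T \<Longrightarrow> t > 0 \<Longrightarrow> (\<forall>B\<in>\<B>. \<forall>x\<in>B. norm (f x) \<le> t) \<Longrightarrow>
       norm (\<Phi> f) \<le> C * t"
    by (rule dual_ucb_topologyE) (rule that; assumption)
  have BX: "x \<in> X" if "B \<in> \<B>" "x \<in> B" for B x
    using \<B>(2)[OF that(1)] that(2) by (auto simp: elcs_bounded_def)
  have pX: "p x \<in> X" for x using Y_subset p_in by blast
  define \<Psi> where "\<Psi> g = (if g \<in> dual smul TY then \<Phi> (extend g) else 0)" for g
  have "\<Psi> \<in> dual fun_scale (ucb_topology smul TY)"
    unfolding dual_ucb_topology_iff
  proof (intro conjI ballI allI impI exI)
    fix f g assume fg: "f \<in> dual smul TY" "g \<in> dual smul TY"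
    have "extend (f + g) = extend f + extend g" by (auto simp: fun_eq_iff extend_def)
    then show "\<Psi> (f + g) = \<Psi> f + \<Psi> g"
      using fg by (simp add: \<Psi>_def dual_add \<Phi>(1) extend_dual)
  next
    fix a f assume f: "f \<in> dual smul TY"
    have "extend (fun_scale a f) = fun_scale a (extend f)"
      by (auto simp: fun_eq_iff extend_def fun_scale_def)
    then show "\<Psi> (fun_scale a f) = a * \<Psi> f"
      using f by (simp add: \<Psi>_def dual_scale \<Phi>(2) extend_dual)
  next
    show "elcs_bounded smul TY B" if "B \<in> (`) p ` \<B>" for B
      using that bounded_imp_projection_bounded \<B>(2) by auto
    fix g and t :: real
    assume "g \<in> dual smul TY" "t > 0" "\<forall>B\<in>(`) p ` \<B>. \<forall>x\<in>B. norm (g x) \<le> t"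
    then show "norm (\<Psi> g) \<le> C * t"
      using bd[OF extend_dual, of g t] by (auto simp: \<Psi>_def extend_def)
  qed (use \<B>(1) in \<open>auto simp: \<Psi>_def\<close>)
  then obtain y where y: "y \<in> Y" "\<And>g. g \<in> dual smul TY \<Longrightarrow> \<Psi> g = g y"
    using assms unfolding semi_reflexive_iff[OF vector_space_axioms] topspace_TY by blast
  define N where "N = {f \<in> dual smul T. \<forall>y\<in>Y. f y = 0}"
  \<comment> \<open>Representatives of the cosets of \<open>Y\<close> met by the dominating bounded
    sets; an \<open>f\<close> in \<open>N\<close> takes on those sets only its values on
    \<open>F\<close>.\<close>
  define F where "F = (\<Union>B\<in>\<B>. (\<lambda>x. x - p x) ` B)"
  have F: "finite F" using \<B> bounded_imp_finite_cosets by (simp add: F_def)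
  have FX: "F \<subseteq> X" using BX pX subspace_diff[OF subspace_topspace] by (auto simp: F_def)
  have "\<exists>c. \<forall>f\<in>N. \<Phi> f = (\<Sum>m\<in>F. c m * f m)"
  proof (rule functional_in_span_of_evaluations[OF F])
    show "(\<lambda>x. f x + g x) \<in> N" "\<Phi> (\<lambda>x. f x + g x) = \<Phi> f + \<Phi> g"
      if "f \<in> N" "g \<in> N" for f g
      using that dual_add[of f smul T g] \<Phi>(1)[of f g] by (auto simp: N_def plus_fun_def)
    show "(\<lambda>x. a * f x) \<in> N" "\<Phi> (\<lambda>x. a * f x) = a * \<Phi> f" if "f \<in> N" for a f
      using that dual_scale[of f smul T a] \<Phi>(2)[of f a] by (auto simp: N_def fun_scale_def)
    fix f assume f: "f \<in> N" "\<And>m. m \<in> F \<Longrightarrow> f m = 0"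
    have f': "f \<in> dual smul T" "\<And>y. y \<in> Y \<Longrightarrow> f y = 0" using f(1) by (auto simp: N_def)
    have f0: "f x = 0" if "B \<in> \<B>" "x \<in> B" for B x
    proof -
      have "x - p x \<in> F" using that by (auto simp: F_def)
      moreover have "f ((x - p x) + p x) = f (x - p x) + f (p x)"
        using f'(1) FX \<open>x - p x \<in> F\<close> pX unfolding dual_def by blast
      ultimately show ?thesis using f(2) f'(2) by simp
    qed
    \<comment> \<open>As \<open>f\<close> vanishes on all sets in \<open>\<B>\<close>, every
      positive \<open>t\<close> is an admissible bound, which forces
      \<open>\<Phi> f = 0\<close>.\<close>
    have le: "norm (\<Phi> f) \<le> C * t" if "t > 0" for t
      using bd[OF f'(1) that] f0 that by simp
    show "\<Phi> f = 0"
    proof (rule ccontr)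
      assume "\<Phi> f \<noteq> 0"
      then have pos: "norm (\<Phi> f) > 0" by simp
      have "C > 0" using le[of 1] pos by linarith
      then have "norm (\<Phi> f) \<le> norm (\<Phi> f) / 2"
        using le[of "norm (\<Phi> f) / (2 * C)"] pos by simp
      then show False using pos by simp
    qed
  qed
  then obtain c where c: "\<And>f. f \<in> N \<Longrightarrow> \<Phi> f = (\<Sum>m\<in>F. c m * f m)" by blast
  \<comment> \<open>The coefficients are valid on \<open>N\<close> only. Subtracting from
    \<open>f\<close> its part \<open>extend (restr f)\<close> moves it into \<open>N\<close>, with
    value \<open>f (m - p m)\<close> at \<open>m\<close>; hence \<open>m - p m\<close> in this
    sum.\<close>
  define z where "z = (\<Sum>m\<in>F. smul (c m) (m - p m))"
  have zX: "z \<in> X"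
    unfolding z_def using FX pX
    by (intro subspace_sum[OF subspace_topspace] subspace_scale[OF subspace_topspace]
        subspace_diff[OF subspace_topspace]) auto
  have "\<Phi> f = f (y + z)" if f: "f \<in> dual smul T" for f
  proof -
    have lin: "f (u + v) = f u + f v" "f (smul a u) = a * f u" if "u \<in> X" "v \<in> X" for u v a
      using f that by (auto simp: dual_def)
    let ?g = "extend (restr f)"
    have g: "?g \<in> dual smul T" "f - ?g \<in> dual smul T"
      using f by (auto intro: extend_dual restr_dual dual_diff)
    have g_eq: "?g x = f (p x)" if "x \<in> X" for x using that by (simp add: extend_def restr_def)
    have gY: "?g x = f x" if "x \<in> Y" for x using that Y_subset g_eq[of x] by auto
    have fN: "f - ?g \<in> N" using g(2) gY by (auto simp: N_def)
    have diff: "(f - ?g) x = f (x - p x)" if "x \<in> X" for x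
      using that lin(1)[of "x - p x" "p x"] pX subspace_diff[OF subspace_topspace]
      by (simp add: g_eq algebra_simps)
    \<comment> \<open>Linearity of \<open>f\<close> is known on \<open>X\<close> alone, so the
      induction also keeps the partial sums in \<open>X\<close>.\<close>
    have fsum: "f (\<Sum>m\<in>G. smul (c m) (m - p m)) = (\<Sum>m\<in>G. c m * f (m - p m))"
      if "finite G" "G \<subseteq> X" for G
      using that
    proof (induction G rule: finite_induct)
      case empty
      show ?case using lin(1)[of 0 0] subspace_0[OF subspace_topspace] by simp
    next
      case (insert m G)
      have "m - p m \<in> X" "(\<Sum>m\<in>G. smul (c m) (m - p m)) \<in> X"
        using insert.prems pX by (auto intro!: subspace_sum[OF subspace_topspace]
            subspace_scale[OF subspace_topspace] subspace_diff[OF subspace_topspace])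
      then show ?case
        using insert subspace_scale[OF subspace_topspace] by (simp add: lin)
    qed
    \<comment> \<open>Splitting of \<open>f\<close> into a pullback from \<open>Y\<close> and an
      element of the annihilator.\<close>
    have "\<Phi> f = \<Phi> (?g + (f - ?g))" by simp
    also have "\<dots> = \<Phi> ?g + \<Phi> (f - ?g)" using g by (rule \<Phi>(1))
    also have "\<Phi> ?g = f y"
      using y(2)[OF restr_dual[OF f]] restr_dual[OF f] y(1) by (simp add: \<Psi>_def restr_def)
    also have "\<Phi> (f - ?g) = (\<Sum>m\<in>F. c m * f (m - p m))"
      unfolding c[OF fN] using FX by (intro sum.cong refl) (metis diff subsetD)
    also have "\<dots> = f z" unfolding z_def using fsum[OF F FX] by simp
    also have "f y + f z = f (y + z)" using lin(1) y(1) Y_subset zX by auto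
    finally show ?thesis .
  qed
  then show "\<exists>x\<in>X. \<forall>f\<in>dual smul T. \<Phi> f = f x"
    using subspace_add[OF subspace_topspace _ zX] y(1) Y_subset by blast
qed

end

theorem mainTheorem2:
  fixes smul :: "'k::real_or_complex \<Rightarrow> 'v::ab_group_add \<Rightarrow> 'v"
    and T TF :: "'v topology"
  assumes "elcs smul T"
    and "flc_topology smul T TF"
  shows "(semi_reflexive smul T \<longleftrightarrow>
            (\<forall>\<rho>. continuous_extended_seminorm smul T \<rho> \<longrightarrow>
               semi_reflexive smul (subtopology T (fin_part T \<rho>)))) \<and>
         ((\<forall>\<rho>. continuous_extended_seminorm smul T \<rho> \<longrightarrow>
               semi_reflexive smul (subtopology T (fin_part T \<rho>))) \<longleftrightarrow>
            (\<exists>\<rho>. continuous_extended_seminorm smul T \<rho> \<and>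
               semi_reflexive smul (subtopology T (fin_part T \<rho>))))"
proof -
  interpret translation_invariant_space smul T
    using assms(1) by (rule elcs_translation_invariant)
  have iff: "semi_reflexive smul (subtopology T (fin_part T \<rho>)) \<longleftrightarrow> semi_reflexive smul T"
    if \<rho>: "continuous_extended_seminorm smul T \<rho>" for \<rho>
  proof -
    interpret open_subspace smul T "fin_part T \<rho>"
      using \<rho> by unfold_locales
        (auto intro: fin_part_subspace fin_part_open simp: continuous_extended_seminorm_def)
    show ?thesis using semi_reflexive_subspace semi_reflexive_ambient by blast
  qed
  \<comment> \<open>The zero seminorm, whose finite part is all of \<open>X\<close>, makes the
    universal statement imply the existential one.\<close>
  have "continuous_extended_seminorm smul T (\<lambda>_. 0)"
    using subspace_0[OF subspace_topspace]
    by (auto simp: continuous_extended_seminorm_def extended_seminorm_def nbhd_of_zero_def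
        intro!: exI[of _ "topspace T"])
  then show ?thesis using iff by blast
qed

end
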